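(* For any positive constant $C_2$ there exist sufficiently small positive constants $C_0$ and $C_1$ (depending only on $C_2$; in particular independent of $\varepsilon$, $H$, $N_0$, $\Omega$ and $\mathcal T$) such that the following holds. Let $\varepsilon>0$, $H>0$, let $N_0\ge 1$ be an integer, and set $\mathring\Omega:=(0,2\varepsilon)\times(-H,H)$. Let $\Omega\supset\mathring\Omega$, let $u(x,y)=e^{-x/\varepsilon}$ be the exact solution of the equation $-\varepsilon^2\triangle u+u=0$ in $\Omega$ with the corresponding Dirichlet boundary conditions, and let $\mathcal T$ be a triangulation of $\Omega$ that includes as a subtriangulation the triangulation $\mathring{\mathcal T}$ of type B in $\mathring\Omega$ with parameters $(\varepsilon,H,N_0)$. Let $U$ be the finite element solution of this problem on $\mathcal T$ obtained using linear elements without quadrature. If $N_0^{-1}\le C_1$ and $\varepsilon\le C_2H$, then $$\max_{\bar\Omega}|U-u|\ \ge\ C_0\,N_0^{-1}.$$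
   Context: $\Omega\subset\mathbb R^2$ is a bounded polygonal domain and triangulations are conforming. Grid and triangulation of type B in $\mathring\Omega$: let $h:=\varepsilon/N_0$ and $x_i:=hi$ for $i=0,\dots,2N_0$, and consider the rectangular tensor-product grid $\mathring\omega_h:=\{x_i\}_{i=0}^{2N_0}\times\{-H,0,H\}$ in $\mathring\Omega=(0,2\varepsilon)\times(-H,H)$. The triangulation $\mathring{\mathcal T}$ of type B is obtained by cutting each grid rectangle into two triangles by one diagonal, as follows. For every $1\le i\le 2N_0$, each of the two rectangles with vertices $(x_{i-1},0),(x_i,0),(x_{i-1},\pm H),(x_i,\pm H)$ is cut by the diagonal joining $(x_{i-1},0)$ to $(x_i,\pm H)$. Thus each node $(x_i,0)$, $1\le i\le 2N_0-1$, belongs to exactly 6 triangles and shares an edge exactly with the nodes $(x_{i\pm1},0)$, $(x_i,\pm H)$, $(x_{i+1},\pm H)$. "$\mathcal T$ includes $\mathring{\mathcal T}$" means that every triangle of $\mathring{\mathcal T}$ is a triangle of $\mathcal T$; outside $\mathring\Omega$ the triangulation is arbitrary. Linear finite element solution without quadrature: let $S_h$ be the space of continuous functions on $\bar\Omega$ that are affine on each triangle of $\mathcal T$. The solution $U\in S_h$ satisfies $U=u$ at all vertices of $\mathcal T$ on $\partial\Omega$ and $$\varepsilon^2\int_\Omega\nabla U\cdot\nabla\chi\,dx\,dy+\int_\Omega U\chi\,dx\,dy=0\qquad\text{for all }\chi\in S_h\text{ with }\chi=0\text{ on }\partial\Omega.$$ *)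

theory Defs
  imports "HOL-Analysis.Analysis"
begin

definition polygonal_domain :: "(real \<times> real) set \<Rightarrow> bool" where
  "polygonal_domain \<Omega> \<longleftrightarrow>
     open \<Omega> \<and> connected \<Omega> \<and> \<Omega> \<noteq> {} \<and> bounded \<Omega> \<and>
     (\<exists>E. finite E \<and> frontier \<Omega> = (\<Union>(a, b)\<in>E. closed_segment a b))"

text \<open>The library predicate \<^const>\<open>triangulation\<close> is what makes the partition conforming: any two of
  its simplices meet in a common (possibly empty) face.  The requirement on interiors only matters
  if \<open>\<Omega>\<close> is slit, that is, smaller than the interior of its closure.\<close>

definition triangulation_of :: "(real \<times> real) set set \<Rightarrow> (real \<times> real) set \<Rightarrow> bool" where
  "triangulation_of \<T> \<Omega> \<longleftrightarrow>
     triangulation \<T> \<and> (\<forall>K\<in>\<T>. 2 simplex K \<and> interior K \<subseteq> \<Omega>) \<and> \<Union>\<T> = closure \<Omega>"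

definition mesh_vertices :: "(real \<times> real) set set \<Rightarrow> (real \<times> real) set" where
  "mesh_vertices \<T> = {v. \<exists>K\<in>\<T>. v extreme_point_of K}"

text \<open>Each rectangle \<open>[x\<^bsub>i-1\<^esub>, x\<^bsub>i\<^esub>] \<times> [0, H]\<close> or \<open>[x\<^bsub>i-1\<^esub>, x\<^bsub>i\<^esub>] \<times> [-H, 0]\<close> (selected by \<open>s = H\<close> or \<open>s = -H\<close>)
  is cut by the diagonal joining \<open>(x\<^bsub>i-1\<^esub>, 0)\<close> to \<open>(x\<^bsub>i\<^esub>, s)\<close>.\<close>

definition type_B_triangulation :: "real \<Rightarrow> real \<Rightarrow> nat \<Rightarrow> (real \<times> real) set set" where
  "type_B_triangulation \<epsilon> H N\<^sub>0 =
     (let x = (\<lambda>i::nat. (\<epsilon> / real N\<^sub>0) * real i) in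
       \<Union>i\<in>{1..2 * N\<^sub>0}. \<Union>s\<in>{H, - H}.
         {convex hull {(x (i - 1), 0), (x i, 0), (x i, s)},
          convex hull {(x (i - 1), 0), (x (i - 1), s), (x i, s)}})"

text \<open>Functions on \<open>closure \<Omega>\<close> are represented by total functions; values elsewhere are irrelevant.\<close>

definition linear_fe_space ::
    "(real \<times> real) set \<Rightarrow> (real \<times> real) set set \<Rightarrow> (real \<times> real \<Rightarrow> real) set" where
  "linear_fe_space \<Omega> \<T> =
     {v. continuous_on (closure \<Omega>) v \<and> (\<forall>K\<in>\<T>. \<exists>a b. \<forall>p\<in>K. v p = a \<bullet> p + b)}"

text \<open>For a finite element function the gradient exists in the interior of every triangle, hence
  almost everywhere in \<open>\<Omega>\<close>; its unspecified values elsewhere do not affect the integrals below.\<close>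

definition grad :: "(real \<times> real \<Rightarrow> real) \<Rightarrow> real \<times> real \<Rightarrow> real \<times> real" where
  "grad f p = (THE D. GDERIV f p :> D)"

definition is_fe_solution ::
    "real \<Rightarrow> (real \<times> real) set \<Rightarrow> (real \<times> real) set set \<Rightarrow> (real \<times> real \<Rightarrow> real)
       \<Rightarrow> (real \<times> real \<Rightarrow> real) \<Rightarrow> bool" where
  "is_fe_solution \<epsilon> \<Omega> \<T> g U \<longleftrightarrow>
     U \<in> linear_fe_space \<Omega> \<T> \<and>
     (\<forall>v \<in> mesh_vertices \<T> \<inter> frontier \<Omega>. U v = g v) \<and>
     (\<forall>\<phi> \<in> linear_fe_space \<Omega> \<T>. (\<forall>p\<in>frontier \<Omega>. \<phi> p = 0) \<longrightarrow>
        \<epsilon>\<^sup>2 * (LINT p:\<Omega>|lebesgue. grad U p \<bullet> grad \<phi> p) + (LINT p:\<Omega>|lebesgue. U p * \<phi> p) = 0)"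

definition exact_solution :: "real \<Rightarrow> real \<times> real \<Rightarrow> real" where
  "exact_solution \<epsilon> p = exp (- fst p / \<epsilon>)"

lemma exact_solution_pde:
  fixes \<epsilon> x y :: real
  assumes "\<epsilon> > 0"
  shows "- \<epsilon>\<^sup>2 * (deriv (deriv (\<lambda>t. exact_solution \<epsilon> (t, y))) x
                 + deriv (deriv (\<lambda>t. exact_solution \<epsilon> (x, t))) y)
         + exact_solution \<epsilon> (x, y) = 0"
proof -
  have 1: "deriv (\<lambda>t. exact_solution \<epsilon> (t, y)) = (\<lambda>t. - exp (- t / \<epsilon>) / \<epsilon>)"
    by (rule ext, rule DERIV_imp_deriv)
       (use assms in \<open>auto simp: exact_solution_def intro!: derivative_eq_intros\<close>)
  have 2: "deriv (\<lambda>t. - exp (- t / \<epsilon>) / \<epsilon>) x = exp (- x / \<epsilon>) / \<epsilon>\<^sup>2"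
    by (rule DERIV_imp_deriv)
       (use assms in \<open>auto simp: power2_eq_square intro!: derivative_eq_intros\<close>)
  show ?thesis
    unfolding 1 2 using assms by (simp add: exact_solution_def)
qed

end

theory Submission
  imports Defs
begin

text \<open>
  Testing the Galerkin equation with the nodal basis function of \<open>(x\<^sub>i, 0)\<close> gives the standard five-point
  scheme for the Laplacian, but since the diagonals all point in one direction the mass term averages
  \<open>U\<close> over six neighbours that are not symmetric about \<open>x\<^sub>i\<close>. With \<open>\<delta> = 1 / N\<^sub>0\<close>, the exact solution thus leaves a
  residual of about \<open>- (\<delta> / 6) u(x\<^sub>i, 0)\<close>, of first order and of constant sign. If \<open>E\<close> bounds the error at the
  nodes, the differences in \<open>y\<close> and the mass terms of the error are at most \<open>(4 C\<^sub>2\<^sup>2 + 1) E\<close>, so the negative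
  second difference quotients in \<open>x\<close> of the error are at least \<open>exp (- 2) \<delta> / 12 - (4 C\<^sub>2\<^sup>2 + 1) E\<close>. Comparing the midpoint
  of \<open>[0, 2 \<epsilon>]\<close> with its endpoints bounds this quantity by \<open>4 E\<close>.
\<close>

section \<open>Integrals over right triangles\<close>

text \<open>The legs may be negative: this makes both kinds of triangles of type B instances of one family.\<close>

definition right_triangle :: "real \<Rightarrow> real \<Rightarrow> real \<Rightarrow> real \<Rightarrow> (real \<times> real) set" where
  "right_triangle x y c d = convex hull {(x, y), (x + c, y), (x + c, y + d)}"

text \<open>\<open>1 - s\<close>, \<open>s - t\<close> and \<open>t\<close> are the barycentric
  coordinates of the point for the three vertices in their listed order, so the inequalities are the
  nonnegativity of these weights.\<close>

lemma mem_right_triangle: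
  assumes "c \<noteq> 0" "d \<noteq> 0"
  shows "(x + c * s, y + d * t) \<in> right_triangle x y c d \<longleftrightarrow> 0 \<le> t \<and> t \<le> s \<and> s \<le> 1"
proof
  assume "(x + c * s, y + d * t) \<in> right_triangle x y c d"
  then obtain u v w where *: "0 \<le> u" "0 \<le> v" "0 \<le> w" "u + v + w = 1"
    "x + c * s = u * x + v * (x + c) + w * (x + c)" "y + d * t = u * y + v * y + w * (y + d)"
    unfolding right_triangle_def convex_hull_3 by auto
  have u: "u = 1 - v - w" using *(4) by simp
  have "c * s = c * (v + w)" "d * t = d * w"
    using *(5,6) unfolding u by (simp_all add: algebra_simps)
  then show "0 \<le> t \<and> t \<le> s \<and> s \<le> 1" using assms * by simp
next
  assume *: "0 \<le> t \<and> t \<le> s \<and> s \<le> 1"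
  have "(x + c * s, y + d * t) = (1 - s) *\<^sub>R (x, y) + (s - t) *\<^sub>R (x + c, y) + t *\<^sub>R (x + c, y + d)"
    by (simp add: algebra_simps)
  moreover have "0 \<le> 1 - s" "0 \<le> s - t" "0 \<le> t" "1 - s + (s - t) + t = 1" using * by auto
  ultimately show "(x + c * s, y + d * t) \<in> right_triangle x y c d"
    unfolding right_triangle_def convex_hull_3 by blast
qed

lemma mem_right_triangle_iff:
  assumes "c \<noteq> 0" "d \<noteq> 0"
  shows "(a, b) \<in> right_triangle x y c d \<longleftrightarrow> 0 \<le> (b - y) / d \<and> (b - y) / d \<le> (a - x) / c \<and> (a - x) / c \<le> 1"
  using mem_right_triangle[OF assms, of x "(a - x) / c" y "(b - y) / d"] assms by simp

lemma right_triangle_cases: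
  assumes "p \<in> right_triangle x y c d" "c \<noteq> 0" "d \<noteq> 0"
  obtains s t where "p = (x + c * s, y + d * t)" "0 \<le> t" "t \<le> s" "s \<le> 1"
proof -
  have "p = (x + c * ((fst p - x) / c), y + d * ((snd p - y) / d))"
    using assms(2,3) by simp
  with assms that show ?thesis using mem_right_triangle by metis
qed

lemma right_triangle_vertices:
  "(x, y) \<in> right_triangle x y c d" "(x + c, y) \<in> right_triangle x y c d"
  "(x + c, y + d) \<in> right_triangle x y c d"
  unfolding right_triangle_def by (auto intro: hull_inc)

lemma affine_on_right_triangle:
  fixes g :: "real \<times> real \<Rightarrow> real"
  assumes "c \<noteq> 0" "d \<noteq> 0"
    and g: "\<And>s t. 0 \<le> t \<Longrightarrow> t \<le> s \<Longrightarrow> s \<le> 1 \<Longrightarrow> g (x + c * s, y + d * t) = A + B * s + C * t"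
  shows "\<exists>a b. \<forall>p\<in>right_triangle x y c d. g p = a \<bullet> p + b"
proof (intro exI ballI)
  fix p assume "p \<in> right_triangle x y c d"
  then obtain s t where st: "p = (x + c * s, y + d * t)" "0 \<le> t" "t \<le> s" "s \<le> 1"
    by (rule right_triangle_cases[OF _ assms(1,2)])
  show "g p = (B / c, C / d) \<bullet> p + (A - B * x / c - C * y / d)"
    unfolding st(1) g[OF st(2-4)] using assms(1,2) by (simp add: field_simps)
qed

lemma compact_right_triangle: "compact (right_triangle x y c d)"
  unfolding right_triangle_def by (intro finite_imp_compact_convex_hull) auto

section \<open>Exact integration of products of affine functions\<close>

lemma set_integrable_lebesgue_compact:
  fixes f :: "'a::euclidean_space \<Rightarrow> real"
  assumes "compact S" "continuous_on S f"
  shows "set_integrable lebesgue S f"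
proof -
  have *: "integrable lborel (\<lambda>x. indicator S x *\<^sub>R f x)"
    by (rule borel_integrable_compact[OF assms])
  then show ?thesis
    unfolding set_integrable_def using integrable_completion by blast
qed

text \<open>The weak form integrates over \<open>lebesgue\<close>, while Fubini and the fundamental
  theorem of calculus are applied over \<open>lborel\<close>; a continuous integrand on a compact
  set is Borel measurable, so both integrals agree.\<close>

lemma set_integral_lebesgue_compact:
  fixes f :: "'a::euclidean_space \<Rightarrow> real"
  assumes "compact S" "continuous_on S f"
  shows "(LINT p:S|lebesgue. f p) = (LINT p|lborel. indicator S p *\<^sub>R f p)"
proof -
  have *: "integrable lborel (\<lambda>x. indicator S x *\<^sub>R f x)"
    by (rule borel_integrable_compact[OF assms])
  then show ?thesis
    unfolding set_lebesgue_integral_def by (intro integral_completion) auto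
qed

text \<open>Fubini followed by an affine substitution in each coordinate; the absolute value of the
  Jacobian takes care of negative legs.\<close>

lemma set_integral_right_triangle:
  assumes cd: "c \<noteq> 0" "d \<noteq> 0" and cont: "continuous_on (right_triangle x y c d) f"
  shows "(LINT p:right_triangle x y c d|lebesgue. f p) =
    \<bar>c * d\<bar> * (LINT s|lborel. indicator {0..1} s *\<^sub>R (LINT t|lborel. indicator {0..s} t *\<^sub>R f (x + c * s, y + d * t)))"
    (is "_ = _ * ?J")
proof -
  let ?K = "right_triangle x y c d"
  let ?F = "\<lambda>p. indicator ?K p *\<^sub>R f p"
  have int: "integrable (lborel \<Otimes>\<^sub>M lborel) ?F"
    using borel_integrable_compact[OF compact_right_triangle cont] by (simp add: lborel_prod)
  have ind: "indicator ?K (x + c * s, y + d * t) = (indicator {0..1} s * indicator {0..s} t :: real)" for s t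
    by (auto simp: indicator_def mem_right_triangle[OF cd])
  have "(LINT p:?K|lebesgue. f p) = (LINT p|lborel. ?F p)"
    by (rule set_integral_lebesgue_compact[OF compact_right_triangle cont])
  also have "\<dots> = integral\<^sup>L (lborel \<Otimes>\<^sub>M lborel) ?F"
    by (simp only: lborel_prod)
  also have "\<dots> = (LINT a|lborel. (LINT b|lborel. ?F (a, b)))"
    by (rule lborel_pair.integral_fst'[OF int, symmetric])
  also have "\<dots> = \<bar>c\<bar> * (LINT s|lborel. (LINT b|lborel. ?F (x + c * s, b)))"
    by (subst lborel_integral_real_affine[OF cd(1), where t = x]) simp
  also have "\<dots> = \<bar>c\<bar> * (LINT s|lborel. \<bar>d\<bar> * (LINT t|lborel. ?F (x + c * s, y + d * t)))"
    by (subst lborel_integral_real_affine[OF cd(2), where t = y]) simp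
  also have "\<dots> = \<bar>c\<bar> * (LINT s|lborel. \<bar>d\<bar> * (indicator {0..1} s *\<^sub>R (LINT t|lborel. indicator {0..s} t *\<^sub>R f (x + c * s, y + d * t))))"
    by (simp add: ind mult.assoc)
  finally show ?thesis by (simp add: abs_mult)
qed

text \<open>The denominators are moments of the reference triangle
  \<open>0 \<le> t \<le> s \<le> 1\<close>: the monomials 1, s, t, s^2, s t, t^2 integrate to 1/2,
  1/3, 1/6, 1/4, 1/8, 1/12.\<close>

lemma set_integral_right_triangle_poly:
  assumes cd: "c \<noteq> 0" "d \<noteq> 0"
    and f: "\<And>s t. 0 \<le> t \<Longrightarrow> t \<le> s \<Longrightarrow> s \<le> 1 \<Longrightarrow> f (x + c * s, y + d * t) = A + B * s + C * t"
    and g: "\<And>s t. 0 \<le> t \<Longrightarrow> t \<le> s \<Longrightarrow> s \<le> 1 \<Longrightarrow> g (x + c * s, y + d * t) = A' + B' * s + C' * t"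
    and cont: "continuous_on (right_triangle x y c d) f" "continuous_on (right_triangle x y c d) g"
  shows "(LINT p:right_triangle x y c d|lebesgue. f p * g p) = \<bar>c * d\<bar> *
    (A * A' / 2 + (A * B' + A' * B) / 3 + (A * C' + A' * C) / 6 + B * B' / 4 + (B * C' + B' * C) / 8 + C * C' / 12)"
proof -
  let ?in = "\<lambda>s. (A + B * s) * (A' + B' * s) * s + ((A + B * s) * C' + (A' + B' * s) * C) * s\<^sup>2 / 2 + C * C' * s^3 / 3"
  have inner: "(LINT t|lborel. indicator {0..s} t *\<^sub>R (f (x + c * s, y + d * t) * g (x + c * s, y + d * t))) = ?in s"
    if s: "0 \<le> s" "s \<le> 1" for s
  proof -
    have "(LINT t|lborel. indicator {0..s} t *\<^sub>R (f (x + c * s, y + d * t) * g (x + c * s, y + d * t)))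
      = (LINT t|lborel. ((A + B * s + C * t) * (A' + B' * s + C' * t)) * indicator {0..s} t)"
      using s by (intro Bochner_Integration.integral_cong) (auto simp: indicator_def f g)
    also have "\<dots> = ((A + B * s) * (A' + B' * s) * s + ((A + B * s) * C' + (A' + B' * s) * C) * s\<^sup>2 / 2 + C * C' * s^3 / 3) - 0"
      by (subst integral_FTC_Icc_real[where F = "\<lambda>t. (A + B * s) * (A' + B' * s) * t + ((A + B * s) * C' + (A' + B' * s) * C) * t\<^sup>2 / 2 + C * C' * t^3 / 3"])
         (use s in \<open>auto intro!: derivative_eq_intros continuous_intros simp: power2_eq_square algebra_simps\<close>)
    finally show ?thesis by simp
  qed
  have "(LINT s|lborel. indicator {0..1} s *\<^sub>R (LINT t|lborel. indicator {0..s} t *\<^sub>R (f (x + c * s, y + d * t) * g (x + c * s, y + d * t))))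
    = (LINT s|lborel. ?in s * indicator {0..1} s)"
  proof (intro Bochner_Integration.integral_cong refl)
    fix s :: real
    show "indicator {0..1} s *\<^sub>R (LINT t|lborel. indicator {0..s} t *\<^sub>R (f (x + c * s, y + d * t) * g (x + c * s, y + d * t))) =
      ?in s * indicator {0..1} s"
    proof (cases "s \<in> {0..1}")
      case True
      then have "0 \<le> s" "s \<le> 1" by auto
      then show ?thesis
        using True by (simp only: inner indicator_simps scaleR_one mult_1_right)
    next
      case False
      then show ?thesis
        unfolding indicator_simps(2)[OF False] by simp
    qed
  qed
  also have "\<dots> = (A * A' / 2 + (A * B' + A' * B) / 3 + (A * C' + A' * C) / 6 + B * B' / 4 + (B * C' + B' * C) / 8 + C * C' / 12) - 0"
    by (subst integral_FTC_Icc_real[where F = "\<lambda>s. A * A' * s\<^sup>2 / 2 + (A * B' + A' * B) * s^3 / 3 + (A * C' + A' * C) * s^3 / 6 + B * B' * s^4 / 4 + (B * C' + B' * C) * s^4 / 8 + C * C' * s^4 / 12"])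
       (auto intro!: derivative_eq_intros continuous_intros simp: power2_eq_square power3_eq_cube field_simps)
  finally show ?thesis
    using set_integral_right_triangle[OF cd, of x y "\<lambda>p. f p * g p"] cont
    by (simp add: continuous_on_mult)
qed

text \<open>The contribution of a right triangle with legs \<open>c\<close> and \<open>d\<close> to the discrete bilinear form, in terms of
  the vertex values listed with the right angle in the middle.\<close>

definition element_form :: "real \<Rightarrow> real \<Rightarrow> real \<Rightarrow> real \<times> real \<times> real \<Rightarrow> real \<times> real \<times> real \<Rightarrow> real" where
  "element_form \<epsilon> c d = (\<lambda>(f0, f1, f2) (g0, g1, g2).
     \<bar>c * d\<bar> * (\<epsilon>\<^sup>2 / 2 * ((f1 - f0) * (g1 - g0) / c\<^sup>2 + (f2 - f1) * (g2 - g1) / d\<^sup>2)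
       + (f0 * g0 + f1 * g1 + f2 * g2 + (f0 + f1 + f2) * (g0 + g1 + g2)) / 24))"

text \<open>The gradient components are the difference quotients along the two legs, so the
  stiffness part has no coupling along the hypotenuse. The mass part is the exact mass matrix of a
  linear triangle: a twelfth of the area times the identity plus the all-ones matrix.\<close>

lemma element_form_eq:
  fixes f g :: "real \<times> real \<Rightarrow> real"
  assumes cd: "c \<noteq> 0" "d \<noteq> 0"
    and f: "\<And>p. p \<in> right_triangle x y c d \<Longrightarrow> f p = a \<bullet> p + b"
    and g: "\<And>p. p \<in> right_triangle x y c d \<Longrightarrow> g p = a' \<bullet> p + b'"
  shows "\<epsilon>\<^sup>2 * (LINT p:right_triangle x y c d|lebesgue. a \<bullet> a') + (LINT p:right_triangle x y c d|lebesgue. f p * g p)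
    = element_form \<epsilon> c d (f (x, y), f (x + c, y), f (x + c, y + d)) (g (x, y), g (x + c, y), g (x + c, y + d))"
proof -
  let ?K = "right_triangle x y c d"
  have vert: "(x, y) \<in> ?K" "(x + c, y) \<in> ?K" "(x + c, y + d) \<in> ?K"
    unfolding right_triangle_def by (auto intro: hull_inc)
  have cont: "continuous_on ?K f" "continuous_on ?K g"
    by (subst continuous_on_cong[OF refl f]; auto intro!: continuous_intros)
       (subst continuous_on_cong[OF refl g]; auto intro!: continuous_intros)
  have K: "(x + c * s, y + d * t) \<in> ?K" if "0 \<le> t" "t \<le> s" "s \<le> 1" for s t
    using that mem_right_triangle[OF cd] by blast
  \<comment> \<open>The factor 1 turns the constant into a product to which the moment formula
    applies.\<close>
  have 1: "(LINT p:?K|lebesgue. (a \<bullet> a') * 1) = \<bar>c * d\<bar> * (a \<bullet> a') / 2"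
    by (subst set_integral_right_triangle_poly[OF cd, where A = "a \<bullet> a'" and B = 0 and C = 0 and A' = 1 and B' = 0 and C' = 0]) auto
  have 2: "(LINT p:?K|lebesgue. f p * g p) = \<bar>c * d\<bar> * (let
      A = f (x, y); B = fst a * c; C = snd a * d; A' = g (x, y); B' = fst a' * c; C' = snd a' * d in
     A * A' / 2 + (A * B' + A' * B) / 3 + (A * C' + A' * C) / 6 + B * B' / 4 + (B * C' + B' * C) / 8 + C * C' / 12)"
    unfolding Let_def
  proof (rule set_integral_right_triangle_poly[OF cd _ _ cont])
    fix s t :: real assume st: "0 \<le> t" "t \<le> s" "s \<le> 1"
    show "f (x + c * s, y + d * t) = f (x, y) + fst a * c * s + snd a * d * t"
      unfolding f[OF K[OF st]] f[OF vert(1)] by (simp add: inner_prod_def algebra_simps)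
    show "g (x + c * s, y + d * t) = g (x, y) + fst a' * c * s + snd a' * d * t"
      unfolding g[OF K[OF st]] g[OF vert(1)] by (simp add: inner_prod_def algebra_simps)
  qed
  have d: "f (x + c, y) = f (x, y) + fst a * c" "f (x + c, y + d) = f (x, y) + fst a * c + snd a * d"
    "g (x + c, y) = g (x, y) + fst a' * c" "g (x + c, y + d) = g (x, y) + fst a' * c + snd a' * d"
    unfolding f[OF vert(1)] f[OF vert(2)] f[OF vert(3)] g[OF vert(1)] g[OF vert(2)] g[OF vert(3)]
    by (simp_all add: inner_prod_def algebra_simps)
  have e: "a \<bullet> a' = (fst a * c) * (fst a' * c) / c\<^sup>2 + (snd a * d) * (snd a' * d) / d\<^sup>2"
    using cd by (simp add: inner_prod_def power2_eq_square)
  have 3: "(LINT p:?K|lebesgue. a \<bullet> a') = \<bar>c * d\<bar> * (B * B' / c\<^sup>2 + D * D' / d\<^sup>2) / 2"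
    if "B = fst a * c" "D = snd a * d" "B' = fst a' * c" "D' = snd a' * d" for B D B' D'
    using 1 unfolding that e[symmetric] by simp
  have "\<epsilon>\<^sup>2 * (\<bar>c * d\<bar> * (B * B' / c\<^sup>2 + D * D' / d\<^sup>2) / 2) + \<bar>c * d\<bar> *
      (A * A' / 2 + (A * B' + A' * B) / 3 + (A * D' + A' * D) / 6 + B * B' / 4 + (B * D' + B' * D) / 8 + D * D' / 12)
    = element_form \<epsilon> c d (A, A + B, A + B + D) (A', A' + B', A' + B' + D')" for A B D A' B' D'
    unfolding element_form_def prod.case by (simp add: field_simps)
  then show ?thesis
    unfolding 2 d Let_def 3[OF refl refl refl refl] by blast
qed

section \<open>Assembly over a triangulation\<close>

text \<open>\<open>grad\<close> is a definite description, so uniqueness is required as well: a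
  vector is determined by its inner products. The affine formula is known on \<open>K\<close> only,
  hence the restriction to interior points.\<close>

lemma grad_affine:
  fixes f :: "real \<times> real \<Rightarrow> real"
  assumes "\<And>q. q \<in> K \<Longrightarrow> f q = a \<bullet> q + b" and p: "p \<in> interior K"
  shows "grad f p = a"
proof -
  have "((\<lambda>q. a \<bullet> q + b) has_derivative (\<lambda>h. h \<bullet> a)) (at p)"
    by (auto intro!: derivative_eq_intros simp: inner_commute)
  then have d: "(f has_derivative (\<lambda>h. h \<bullet> a)) (at p)"
    by (rule has_derivative_transform_within_open[OF _ open_interior p])
       (use assms(1) interior_subset in fastforce)
  show ?thesis
    unfolding grad_def
  proof (rule the_equality)
    show "GDERIV f p :> a" using d by (simp add: gderiv_def)
  next
    fix D assume "GDERIV f p :> D"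
    then have "(\<lambda>h. h \<bullet> D) = (\<lambda>h. h \<bullet> a)"
      using d has_derivative_unique unfolding gderiv_def by blast
    then show "D = a"
      by (metis inner_commute vector_eq_rdot)
  qed
qed

lemma interior_simplex_dim2:
  fixes K :: "(real \<times> real) set"
  assumes "2 simplex K"
  shows "interior K \<noteq> {}"
proof -
  have "aff_dim K = 2" using assms by (rule aff_dim_simplex)
  then have "interior K = rel_interior K" "K \<noteq> {}"
    by (auto simp: interior_rel_interior_gen)
  then show ?thesis
    using convex_simplex[OF assms] rel_interior_eq_empty by metis
qed

lemma triangulation_interior_eq:
  assumes "triangulation \<T>" "K \<in> \<T>" "K' \<in> \<T>" "2 simplex K" "2 simplex K'" "p \<in> interior K" "p \<in> K'"
  shows "K' = K"
proof -
  txt \<open>A face that meets the interior is the whole simplex.\<close>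
  have face: "K \<inter> K' face_of K" "K' \<inter> K face_of K'"
    using assms(1-3) unfolding triangulation_def by auto
  have "p \<in> rel_interior K" "p \<in> K"
    using assms(6) interior_subset_rel_interior interior_subset by auto
  then have "K \<inter> K' = K"
    using face_of_disjoint_rel_interior[OF face(1)] assms(7) by auto
  then have f2: "K face_of K'" using face(2) by (simp add: Int_commute)
  \<comment> \<open>\<open>K\<close> is a face of \<open>K'\<close>, and a proper face would have
    smaller dimension, but both are 2.\<close>
  show ?thesis
    using face_of_aff_dim_lt[OF convex_simplex[OF assms(5)] f2]
      aff_dim_simplex[OF assms(4)] aff_dim_simplex[OF assms(5)] by auto
qed

text \<open>Off the element frontiers, which form a null set, every point of \<open>\<Omega>\<close>
  lies in exactly one element. The integrand therefore has to match only on interiors, which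
  disposes of the unspecified values of \<open>grad\<close>.\<close>

lemma set_integral_triangulation:
  fixes F :: "real \<times> real \<Rightarrow> real"
  assumes T: "triangulation_of \<T> \<Omega>"
    and G: "\<And>K. K \<in> \<T> \<Longrightarrow> continuous_on K (G K)"
    and FG: "\<And>K p. K \<in> \<T> \<Longrightarrow> p \<in> interior K \<Longrightarrow> F p = G K p"
  shows "(LINT p:\<Omega>|lebesgue. F p) = (\<Sum>K\<in>\<T>. LINT p:K|lebesgue. G K p)"
proof -
  have tri: "triangulation \<T>" and fin: "finite \<T>" and simp2: "\<And>K. K \<in> \<T> \<Longrightarrow> 2 simplex K"
    and sub: "\<And>K. K \<in> \<T> \<Longrightarrow> interior K \<subseteq> \<Omega>" and un: "\<Union>\<T> = closure \<Omega>"
    using T unfolding triangulation_of_def triangulation_def by auto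
  let ?S = "\<lambda>p. \<Sum>K\<in>\<T>. indicator K p *\<^sub>R G K p"
  let ?L = "\<lambda>p. indicator \<Omega> p *\<^sub>R F p"
  let ?N = "\<Union>K\<in>\<T>. frontier K"
  have int: "integrable lebesgue (\<lambda>p. indicator K p *\<^sub>R G K p)" if "K \<in> \<T>" for K
    using set_integrable_lebesgue_compact[OF compact_simplex[OF simp2[OF that]] G[OF that]]
    by (simp add: set_integrable_def)
  have intS: "integrable lebesgue ?S" using int by auto
  have neg: "negligible ?N"
    using fin simp2 by (intro negligible_Union) (auto intro!: negligible_convex_frontier convex_simplex)
  have eq: "?L p = ?S p" if p: "p \<notin> ?N" for p
  proof -
    have int_iff: "p \<in> K \<longleftrightarrow> p \<in> interior K" if "K \<in> \<T>" for K
      using p that closed_simplex[OF simp2[OF that]] interior_subset[of K]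
      by (auto simp: frontier_def)
    show ?thesis
    proof (cases "p \<in> \<Omega>")
      case True
      then obtain K where K: "K \<in> \<T>" "p \<in> K" using un closure_subset by blast
      then have pi: "p \<in> interior K" using int_iff by blast
      have "?S p = (\<Sum>K'\<in>{K}. indicator K' p *\<^sub>R G K' p)"
      proof (rule sum.mono_neutral_right[OF fin])
        show "\<forall>K'\<in>\<T> - {K}. indicator K' p *\<^sub>R G K' p = 0"
        proof
          fix K' assume K': "K' \<in> \<T> - {K}"
          then have "p \<notin> K'"
            using triangulation_interior_eq[OF tri K(1) _ simp2[OF K(1)] _ pi, of K'] simp2 by blast
          then show "indicator K' p *\<^sub>R G K' p = 0" by simp
        qed
      qed (use K in auto)
      then show ?thesis using True K FG[OF K(1) pi] by simp
    next
      case False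
      then have "p \<notin> K" if "K \<in> \<T>" for K using that int_iff sub by blast
      then show ?thesis using False by simp
    qed
  qed
  \<comment> \<open>No measurability of \<open>F\<close> is assumed; it is inherited from
    \<open>?S\<close>, which differs from \<open>?L\<close> on a null set only.\<close>
  have "?L absolutely_integrable_on UNIV"
    by (rule absolutely_integrable_spike[where f = ?S, OF _ neg])
       (use intS eq in \<open>auto simp: set_integrable_def\<close>)
  then have "integrable lebesgue ?L" by (simp add: set_integrable_def)
  moreover have "AE p in lebesgue. ?L p = ?S p"
    using neg eq unfolding negligible_iff_null_sets
    by (intro AE_I'[of ?N]) auto
  ultimately have "integral\<^sup>L lebesgue ?L = integral\<^sup>L lebesgue ?S"
    using intS by (intro integral_cong_AE) auto
  also have "\<dots> = (\<Sum>K\<in>\<T>. LINT p:K|lebesgue. G K p)"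
    unfolding set_lebesgue_integral_def using int by (intro Bochner_Integration.integral_sum) auto
  finally show ?thesis by (simp add: set_lebesgue_integral_def)
qed

text \<open>The gradient part is taken over the interior, where \<open>grad\<close> is determined by
  the affine piece.\<close>

definition element_energy :: "real \<Rightarrow> (real \<times> real) set \<Rightarrow> (real \<times> real \<Rightarrow> real) \<Rightarrow> (real \<times> real \<Rightarrow> real) \<Rightarrow> real" where
  "element_energy \<epsilon> K f g =
     \<epsilon>\<^sup>2 * (LINT p:interior K|lebesgue. grad f p \<bullet> grad g p) + (LINT p:K|lebesgue. f p * g p)"

text \<open>This is \<open>set_integral_triangulation\<close> for the one-element triangulation
  \<open>{K}\<close> of \<open>interior K\<close>.\<close>

lemma set_integral_interior_simplex:
  fixes G :: "real \<times> real \<Rightarrow> real"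
  assumes "2 simplex K" "continuous_on K G" "\<And>p. p \<in> interior K \<Longrightarrow> F p = G p"
  shows "(LINT p:interior K|lebesgue. F p) = (LINT p:K|lebesgue. G p)"
proof -
  have ne: "interior K \<noteq> {}" by (rule interior_simplex_dim2[OF assms(1)])
  have cl: "closure (interior K) = K"
    using convex_closure_interior[OF convex_simplex[OF assms(1)] ne] closed_simplex[OF assms(1)] by simp
  have "triangulation_of {K} (interior K)"
    unfolding triangulation_of_def triangulation_def
    using assms(1) cl convex_simplex[OF assms(1)] by (auto intro: face_of_refl)
  from set_integral_triangulation[OF this, where G = "\<lambda>_. G" and F = F] assms(2,3)
  show ?thesis by simp
qed

section \<open>Localisation of the weak form to the support of the test function\<close>

lemma affine_on_elements:
  assumes "f \<in> linear_fe_space \<Omega> \<T>"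
  shows "\<exists>a b. \<forall>K\<in>\<T>. \<forall>p\<in>K. f p = a K \<bullet> p + b K"
proof -
  have "\<forall>K\<in>\<T>. \<exists>a b. \<forall>p\<in>K. f p = a \<bullet> p + b"
    using assms unfolding linear_fe_space_def by (rule CollectE) (erule conjunct2)
  then have "\<exists>a. \<forall>K\<in>\<T>. \<exists>b. \<forall>p\<in>K. f p = a K \<bullet> p + b" by (rule bchoice)
  then obtain a where "\<forall>K\<in>\<T>. \<exists>b. \<forall>p\<in>K. f p = a K \<bullet> p + b" ..
  then have "\<exists>b. \<forall>K\<in>\<T>. \<forall>p\<in>K. f p = a K \<bullet> p + b K" by (rule bchoice)
  then show ?thesis by blast
qed

text \<open>On an element where \<open>g\<close> vanishes its gradient vanishes in the interior, so
  only the elements in \<open>S\<close> contribute; this is how the arbitrary mesh outside the patch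
  drops out.\<close>

lemma fe_form_eq_sum:
  assumes T: "triangulation_of \<T> \<Omega>"
    and f: "f \<in> linear_fe_space \<Omega> \<T>" and g: "g \<in> linear_fe_space \<Omega> \<T>"
    and S: "S \<subseteq> \<T>" "\<And>K p. K \<in> \<T> - S \<Longrightarrow> p \<in> K \<Longrightarrow> g p = 0"
  shows "\<epsilon>\<^sup>2 * (LINT p:\<Omega>|lebesgue. grad f p \<bullet> grad g p) + (LINT p:\<Omega>|lebesgue. f p * g p)
    = (\<Sum>K\<in>S. element_energy \<epsilon> K f g)"
proof -
  have fin: "finite \<T>" and simp2: "\<And>K. K \<in> \<T> \<Longrightarrow> 2 simplex K" and un: "\<Union>\<T> = closure \<Omega>"
    using T unfolding triangulation_of_def triangulation_def by auto
  obtain a b where ab: "\<And>K p. K \<in> \<T> \<Longrightarrow> p \<in> K \<Longrightarrow> f p = a K \<bullet> p + b K"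
    using affine_on_elements[OF f] by blast
  obtain a' b' where ab': "\<And>K p. K \<in> \<T> \<Longrightarrow> p \<in> K \<Longrightarrow> g p = a' K \<bullet> p + b' K"
    using affine_on_elements[OF g] by blast
  have gr: "grad f p \<bullet> grad g p = a K \<bullet> a' K" if "K \<in> \<T>" "p \<in> interior K" for K p
    using grad_affine[OF ab[OF that(1)] that(2)] grad_affine[OF ab'[OF that(1)] that(2)] by simp
  have cont: "continuous_on K f" "continuous_on K g" if "K \<in> \<T>" for K
    using f g that un unfolding linear_fe_space_def
    by (auto intro: continuous_on_subset)
  have 1: "(LINT p:\<Omega>|lebesgue. grad f p \<bullet> grad g p) = (\<Sum>K\<in>\<T>. LINT p:K|lebesgue. a K \<bullet> a' K)"
    by (rule set_integral_triangulation[OF T]) (auto simp: gr)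
  have 2: "(LINT p:\<Omega>|lebesgue. f p * g p) = (\<Sum>K\<in>\<T>. LINT p:K|lebesgue. f p * g p)"
    by (rule set_integral_triangulation[OF T]) (auto intro: continuous_on_mult cont)
  have el: "element_energy \<epsilon> K f g = \<epsilon>\<^sup>2 * (LINT p:K|lebesgue. a K \<bullet> a' K) + (LINT p:K|lebesgue. f p * g p)"
    if "K \<in> \<T>" for K
    unfolding element_energy_def
    by (subst set_integral_interior_simplex[OF simp2[OF that], where G = "\<lambda>_. a K \<bullet> a' K"])
       (auto simp: gr that)
  have 0: "element_energy \<epsilon> K f g = 0" if K: "K \<in> \<T> - S" for K
  proof -
    have "grad g p = 0" if "p \<in> interior K" for p
      by (rule grad_affine[of K g 0 0 p]) (use K S that in auto)
    then have "grad f p \<bullet> grad g p = 0" if "p \<in> interior K" for p using that by simp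
    then have "(LINT p:interior K|lebesgue. grad f p \<bullet> grad g p) = (LINT p:interior K|lebesgue. 0)"
      unfolding set_lebesgue_integral_def by (intro Bochner_Integration.integral_cong) (auto simp: indicator_def)
    moreover have "(LINT p:K|lebesgue. f p * g p) = (LINT p:K|lebesgue. 0)"
      unfolding set_lebesgue_integral_def
      using S(2)[OF K] by (intro Bochner_Integration.integral_cong) (auto simp: indicator_def)
    ultimately show ?thesis by (simp add: element_energy_def)
  qed
  have "\<epsilon>\<^sup>2 * (LINT p:\<Omega>|lebesgue. grad f p \<bullet> grad g p) + (LINT p:\<Omega>|lebesgue. f p * g p)
    = (\<Sum>K\<in>\<T>. element_energy \<epsilon> K f g)"
    unfolding 1 2 by (simp add: el sum.distrib sum_distrib_left)
  also have "\<dots> = (\<Sum>K\<in>S. element_energy \<epsilon> K f g)"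
    using S(1) fin 0 by (intro sum.mono_neutral_right) auto
  finally show ?thesis .
qed

lemma element_energy_right_triangle:
  assumes "2 simplex right_triangle x y c d" "c \<noteq> 0" "d \<noteq> 0"
    and "\<exists>a b. \<forall>p\<in>right_triangle x y c d. f p = a \<bullet> p + b"
    and "\<exists>a b. \<forall>p\<in>right_triangle x y c d. g p = a \<bullet> p + b"
  shows "element_energy \<epsilon> (right_triangle x y c d) f g
    = element_form \<epsilon> c d (f (x, y), f (x + c, y), f (x + c, y + d)) (g (x, y), g (x + c, y), g (x + c, y + d))"
proof -
  let ?K = "right_triangle x y c d"
  obtain a b a' b' where ab: "\<And>p. p \<in> ?K \<Longrightarrow> f p = a \<bullet> p + b" and ab': "\<And>p. p \<in> ?K \<Longrightarrow> g p = a' \<bullet> p + b'"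
    using assms(4,5) by auto
  have "(LINT p:interior ?K|lebesgue. grad f p \<bullet> grad g p) = (LINT p:?K|lebesgue. a \<bullet> a')"
  proof (rule set_integral_interior_simplex[OF assms(1)])
    fix p assume "p \<in> interior ?K"
    then show "grad f p \<bullet> grad g p = a \<bullet> a'"
      using grad_affine[of ?K f a b p] grad_affine[of ?K g a' b' p] ab ab' by simp
  qed auto
  then show ?thesis
    unfolding element_energy_def using element_form_eq[OF assms(2,3) ab ab'] by simp
qed

section \<open>The difference equation on the type B patch\<close>

text \<open>The nodal basis function of \<open>(x, 0)\<close>: on each half plane it is the minimum of the three affine
  functions that vanish on the sides of its support and equal 1 at the node.\<close>

definition hat :: "real \<Rightarrow> real \<Rightarrow> real \<Rightarrow> real \<times> real \<Rightarrow> real" where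
  "hat x h H p = (let s = (fst p - x) / h; t = \<bar>snd p\<bar> / H in
     max 0 (min (1 - s) (min (1 - t) (1 + s - t))))"

text \<open>These are the six type B elements with vertex \<open>(x, 0)\<close>, three on each side
  of the axis. The negative legs of the third put its right angle at \<open>(x, s)\<close> and list
  the node last.\<close>

definition patch :: "real \<Rightarrow> real \<Rightarrow> real \<Rightarrow> (real \<times> real) set set" where
  "patch x h H = (\<Union>s\<in>{H, - H}. {right_triangle (x - h) 0 h s, right_triangle x 0 h s,
     right_triangle (x + h) s (- h) (- s)})"

section \<open>Support and piecewise affinity of the hat function\<close>

lemma continuous_on_hat: "h \<noteq> 0 \<Longrightarrow> H \<noteq> 0 \<Longrightarrow> continuous_on S (hat x h H)"
  unfolding hat_def[abs_def] Let_def
  by (intro continuous_intros) auto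

lemma hat_nonzero_box:
  assumes "hat x h H p \<noteq> 0" "h > 0" "H > 0"
  shows "p \<in> {x - h<..<x + h} \<times> {- H<..<H}"
proof -
  obtain a b where p: "p = (a, b)" by (cases p)
  define s t where "s = (a - x) / h" and "t = \<bar>b\<bar> / H"
  have "0 \<le> t" using assms(3) by (simp add: t_def)
  then have "s < 1" "t < 1" "- 1 < s"
    using assms(1) unfolding hat_def p Let_def fst_conv snd_conv s_def[symmetric] t_def[symmetric]
    by (auto simp: max_def min_def split: if_splits)
  then show ?thesis
    using assms(2,3) unfolding p s_def t_def by (auto simp: field_simps)
qed

lemma hat_nonzero_patch:
  assumes "hat x h H p \<noteq> 0" "h > 0" "H > 0"
  obtains K where "K \<in> patch x h H" "p \<in> K"
proof -
  obtain a b where p: "p = (a, b)" by (cases p)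
  define s t where "s = (a - x) / h" and "t = \<bar>b\<bar> / H"
  define \<sigma> where "\<sigma> = (if b < 0 then - H else H)"
  have \<sigma>: "\<sigma> \<in> {H, - H}" "\<sigma> \<noteq> 0" using assms by (auto simp: \<sigma>_def)
  have ab: "a = x + h * s" "b = \<sigma> * t"
    using assms by (auto simp: s_def t_def \<sigma>_def)
  have "0 \<le> t" using assms(3) by (simp add: t_def)
  then have st: "s < 1" "t < 1" "0 < 1 + s - t" "0 \<le> t"
    using assms(1) unfolding hat_def p Let_def fst_conv snd_conv s_def[symmetric] t_def[symmetric]
    by (auto simp: max_def min_def split: if_splits)
  \<comment> \<open>The first case is the element left of the node; to its right the line
    \<open>s = t\<close> is the diagonal that separates the other two elements.\<close>
  consider "s < 0" | "0 \<le> s" "s \<le> t" | "t \<le> s" by linarith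
  then show ?thesis
  proof cases
    case 1
    have "p = ((x - h) + h * (1 + s), 0 + \<sigma> * t)" by (simp add: p ab algebra_simps)
    also have "\<dots> \<in> right_triangle (x - h) 0 h \<sigma>"
      using mem_right_triangle[of h \<sigma> "x - h" "1 + s" 0 t] 1 st assms(2) \<sigma>(2) by simp
    finally show ?thesis using that \<sigma>(1) unfolding patch_def by blast
  next
    case 2
    have "p = ((x + h) + (- h) * (1 - s), \<sigma> + (- \<sigma>) * (1 - t))" by (simp add: p ab algebra_simps)
    also have "\<dots> \<in> right_triangle (x + h) \<sigma> (- h) (- \<sigma>)"
      using mem_right_triangle[of "- h" "- \<sigma>" "x + h" "1 - s" \<sigma> "1 - t"] 2 st assms(2) \<sigma>(2) by simp
    finally show ?thesis using that \<sigma>(1) unfolding patch_def by blast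
  next
    case 3
    have "p = (x + h * s, 0 + \<sigma> * t)" by (simp add: p ab)
    also have "\<dots> \<in> right_triangle x 0 h \<sigma>"
      using mem_right_triangle[of h \<sigma> x s 0 t] 3 st assms(2) \<sigma>(2) by simp
    finally show ?thesis using that \<sigma>(1) unfolding patch_def by blast
  qed
qed

text \<open>On each element the minimum is the barycentric coordinate of the node, which is the
  second, first and third listed vertex in turn: \<open>s - t\<close>, \<open>1 - s\<close> and
  \<open>t\<close>.\<close>

lemma hat_affine_patch:
  assumes "h > 0" "H > 0" "K \<in> patch x h H"
  shows "\<exists>a b. \<forall>p\<in>K. hat x h H p = a \<bullet> p + b"
proof -
  obtain \<sigma> where \<sigma>: "\<sigma> \<in> {H, - H}" "\<sigma> \<noteq> 0" "\<bar>\<sigma>\<bar> = H" and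
    K: "K = right_triangle (x - h) 0 h \<sigma> \<or> K = right_triangle x 0 h \<sigma> \<or>
      K = right_triangle (x + h) \<sigma> (- h) (- \<sigma>)"
    using assms unfolding patch_def by force
  have eqs: "(x - h + h * s - x) / h = s - 1" "(x + h * s - x) / h = s" "(x + h + - h * s - x) / h = 1 - s" for s
    using assms(1) by (simp_all add: field_simps)
  have abs: "\<bar>0 + \<sigma> * t\<bar> / H = t" "\<bar>\<sigma> + - \<sigma> * (1 - t)\<bar> / H = t" if "0 \<le> t" for t
  proof -
    show *: "\<bar>0 + \<sigma> * t\<bar> / H = t" using that assms(2) \<sigma>(3) by (simp add: abs_mult)
    have "\<sigma> + - \<sigma> * (1 - t) = 0 + \<sigma> * t" by (simp add: algebra_simps)
    with * show "\<bar>\<sigma> + - \<sigma> * (1 - t)\<bar> / H = t" by simp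
  qed
  from K show ?thesis
  proof (elim disjE)
    assume K: "K = right_triangle (x - h) 0 h \<sigma>"
    show ?thesis unfolding K
    proof (rule affine_on_right_triangle)
      fix s t :: real assume st: "0 \<le> t" "t \<le> s" "s \<le> 1"
      show "hat x h H (x - h + h * s, 0 + \<sigma> * t) = 0 + 1 * s + (- 1) * t"
        unfolding hat_def Let_def fst_conv snd_conv eqs abs(1)[OF st(1)] using st by (auto simp: max_def min_def)
    qed (use assms \<sigma> in auto)
  next
    assume K: "K = right_triangle x 0 h \<sigma>"
    show ?thesis unfolding K
    proof (rule affine_on_right_triangle)
      fix s t :: real assume st: "0 \<le> t" "t \<le> s" "s \<le> 1"
      show "hat x h H (x + h * s, 0 + \<sigma> * t) = 1 + (- 1) * s + 0 * t"
        unfolding hat_def Let_def fst_conv snd_conv eqs abs(1)[OF st(1)] using st by (auto simp: max_def min_def)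
    qed (use assms \<sigma> in auto)
  next
    assume K: "K = right_triangle (x + h) \<sigma> (- h) (- \<sigma>)"
    show ?thesis unfolding K
    proof (rule affine_on_right_triangle)
      fix s t :: real assume st: "0 \<le> t" "t \<le> s" "s \<le> 1"
      have t: "\<bar>\<sigma> + - \<sigma> * t\<bar> / H = 1 - t" using abs(2)[of "1 - t"] st by simp
      show "hat x h H (x + h + - h * s, \<sigma> + - \<sigma> * t) = 0 + 0 * s + 1 * t"
        unfolding hat_def Let_def fst_conv snd_conv eqs t using st by (auto simp: max_def min_def)
    qed (use assms \<sigma> in auto)
  qed
qed

text \<open>The set where the hat is nonzero is open, and \<open>K\<close> is the closure of its
  interior. A nonzero value on \<open>K\<close> would thus give one at an interior point of
  \<open>K\<close>; that point also lies in a patch element, which must then be \<open>K\<close>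
  itself.\<close>

lemma hat_zero_outside_patch:
  assumes "triangulation \<T>" and simp2: "\<And>K. K \<in> \<T> \<Longrightarrow> 2 simplex K"
    and hH: "h > 0" "H > 0" and sub: "patch x h H \<subseteq> \<T>"
    and K: "K \<in> \<T> - patch x h H" "p \<in> K"
  shows "hat x h H p = 0"
proof (rule ccontr)
  assume nz: "hat x h H p \<noteq> 0"
  have op: "open {q. hat x h H q \<noteq> 0}"
    by (rule open_Collect_neq) (use continuous_on_hat[of h H] hH in auto)
  have K2: "2 simplex K" using simp2 K by blast
  have "closure (interior K) = K"
    using convex_closure_interior[OF convex_simplex[OF K2] interior_simplex_dim2[OF K2]]
      closed_simplex[OF K2] by simp
  then have "{q. hat x h H q \<noteq> 0} \<inter> interior K \<noteq> {}"
    using open_Int_closure_eq_empty[OF op, of "interior K"] K(2) nz by blast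
  then obtain q where q: "hat x h H q \<noteq> 0" "q \<in> interior K" by blast
  from hat_nonzero_patch[OF q(1) hH] obtain K' where K': "K' \<in> patch x h H" "q \<in> K'" .
  then have "K' = K"
    using triangulation_interior_eq[OF assms(1) _ _ K2 _ q(2) K'(2)] sub K simp2 by blast
  then show False using K K' by blast
qed

lemma hat_in_linear_fe_space:
  assumes "triangulation \<T>" "\<And>K. K \<in> \<T> \<Longrightarrow> 2 simplex K" "h > 0" "H > 0" "patch x h H \<subseteq> \<T>"
  shows "hat x h H \<in> linear_fe_space \<Omega> \<T>"
proof -
  have "\<exists>a b. \<forall>p\<in>K. hat x h H p = a \<bullet> p + b" if "K \<in> \<T>" for K
  proof (cases "K \<in> patch x h H")
    case False
    then have "\<forall>p\<in>K. hat x h H p = 0 \<bullet> p + 0"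
      using hat_zero_outside_patch[OF assms] that by simp
    then show ?thesis by blast
  qed (rule hat_affine_patch[OF assms(3,4)])
  then show ?thesis
    using continuous_on_hat assms(3,4) unfolding linear_fe_space_def by simp
qed

lemma sum_patch:
  fixes F :: "(real \<times> real) set \<Rightarrow> real"
  assumes "h > 0" "H > 0"
  shows "sum F (patch x h H) = (\<Sum>s\<in>{H, - H}. F (right_triangle (x - h) 0 h s) + F (right_triangle x 0 h s)
    + F (right_triangle (x + h) s (- h) (- s)))"
proof -
  let ?P = "\<lambda>s. right_triangle (x - h) 0 h s" and ?Q = "\<lambda>s. right_triangle x 0 h s"
    and ?R = "\<lambda>s. right_triangle (x + h) s (- h) (- s)"
  \<comment> \<open>The sum has six terms only if the six triangles are distinct sets; each pair is
    separated by a vertex of one that the other does not contain.\<close>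
  have mem: "(x - h, 0) \<in> ?P s" "(x - h, 0) \<notin> ?Q s" "(x - h, 0) \<notin> ?R s"
    "(x + h, 0) \<in> ?Q s" "(x + h, 0) \<notin> ?R s" "(x, s) \<in> ?P s" "(x, s) \<notin> ?P (- s)"
    "(x + h, s) \<in> ?Q s" "(x + h, s) \<notin> ?Q (- s)" "(x + h, s) \<in> ?R s" "(x + h, s) \<notin> ?R (- s)"
    if "s \<in> {H, - H}" for s
    using that assms by (auto simp: mem_right_triangle_iff field_simps)
  have ne: "?P s \<noteq> ?Q t" "?P s \<noteq> ?R t" "?Q s \<noteq> ?R t" if "s \<in> {H, - H}" "t \<in> {H, - H}" for s t
    using mem(1,4)[OF that(1)] mem(2,3,5)[OF that(2)] by metis+
  have nd: "?P H \<noteq> ?P (- H)" "?Q H \<noteq> ?Q (- H)" "?R H \<noteq> ?R (- H)"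
    using mem(6-11)[of H] by auto
  have "patch x h H = {?P H, ?Q H, ?R H, ?P (- H), ?Q (- H), ?R (- H)}"
    unfolding patch_def by auto
  moreover have "sum F {?P H, ?Q H, ?R H, ?P (- H), ?Q (- H), ?R (- H)}
    = F (?P H) + (F (?Q H) + (F (?R H) + (F (?P (- H)) + (F (?Q (- H)) + F (?R (- H))))))"
    using ne[of H H] ne[of H "- H"] ne[of "- H" H] ne[of "- H" "- H"] nd
    by (subst sum.insert; auto)+
  ultimately show ?thesis using assms by simp
qed

text \<open>After division by \<open>h * H\<close>, the node collects 2/24 from each of its six
  elements, giving 1/2, and every neighbour collects 1/24 from each of the two elements it shares
  with the node, giving 1/12. The neighbours \<open>(x + h, H)\<close> and
  \<open>(x + h, - H)\<close> are joined to the node by hypotenuses and so appear in the mass term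
  only.\<close>

lemma fe_difference_equation:
  assumes T: "triangulation_of \<T> \<Omega>" and "open \<Omega>" and sol: "is_fe_solution \<epsilon> \<Omega> \<T> g U"
    and hH: "h > 0" "H > 0" and sub: "patch x h H \<subseteq> \<T>"
    and box: "{x - h<..<x + h} \<times> {- H<..<H} \<subseteq> \<Omega>"
  shows "\<epsilon>\<^sup>2 / h\<^sup>2 * (2 * U (x, 0) - U (x - h, 0) - U (x + h, 0))
    + \<epsilon>\<^sup>2 / H\<^sup>2 * (2 * U (x, 0) - U (x, H) - U (x, - H))
    + U (x, 0) / 2 + (U (x - h, 0) + U (x + h, 0) + U (x, H) + U (x, - H) + U (x + h, H) + U (x + h, - H)) / 12 = 0"
proof -
  let ?\<phi> = "hat x h H"
  define \<alpha> \<beta> where "\<alpha> = \<epsilon>\<^sup>2 / h\<^sup>2" and "\<beta> = \<epsilon>\<^sup>2 / H\<^sup>2"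
  have form: "element_form \<epsilon> c s (f0, f1, f2) (g0, g1, g2) = h * H *
      (\<alpha> * ((f1 - f0) * (g1 - g0)) / 2 + \<beta> * ((f2 - f1) * (g2 - g1)) / 2
        + (f0 * g0 + f1 * g1 + f2 * g2 + (f0 + f1 + f2) * (g0 + g1 + g2)) / 24)"
    if "c = h \<or> c = - h" "s = H \<or> s = - H" for c s f0 f1 f2 g0 g1 g2
  proof -
    have "\<bar>c * s\<bar> = h * H" "c\<^sup>2 = h\<^sup>2" "s\<^sup>2 = H\<^sup>2" using that hH by (auto simp: abs_mult)
    then show ?thesis
      unfolding element_form_def \<alpha>_def \<beta>_def prod.case by (simp add: distrib_left)
  qed
  have tri: "triangulation \<T>" and simp2: "\<And>K. K \<in> \<T> \<Longrightarrow> 2 simplex K"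
    using T unfolding triangulation_of_def by auto
  have hat: "?\<phi> \<in> linear_fe_space \<Omega> \<T>"
    by (rule hat_in_linear_fe_space[OF tri simp2 hH sub])
  have U: "U \<in> linear_fe_space \<Omega> \<T>" using sol unfolding is_fe_solution_def by simp
  have aff: "\<exists>a b. \<forall>p\<in>K. f p = a \<bullet> p + b" if "f \<in> linear_fe_space \<Omega> \<T>" "K \<in> patch x h H" for f K
    using that sub unfolding linear_fe_space_def by blast
  \<comment> \<open>The open set \<open>\<Omega>\<close> is disjoint from its frontier and contains
    the box outside which the hat vanishes, so the hat is an admissible test function.\<close>
  have "?\<phi> p = 0" if "p \<in> frontier \<Omega>" for p
    using hat_nonzero_box[OF _ hH, of x p] box that \<open>open \<Omega>\<close>
    by (auto simp: frontier_def interior_open)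
  then have "0 = \<epsilon>\<^sup>2 * (LINT p:\<Omega>|lebesgue. grad U p \<bullet> grad ?\<phi> p) + (LINT p:\<Omega>|lebesgue. U p * ?\<phi> p)"
    using sol hat unfolding is_fe_solution_def by simp
  also have "\<dots> = (\<Sum>K\<in>patch x h H. element_energy \<epsilon> K U ?\<phi>)"
    by (rule fe_form_eq_sum[OF T U hat sub hat_zero_outside_patch[OF tri simp2 hH sub]])
  also have "\<dots> = (\<Sum>s\<in>{H, - H}. element_energy \<epsilon> (right_triangle (x - h) 0 h s) U ?\<phi>
    + element_energy \<epsilon> (right_triangle x 0 h s) U ?\<phi>
    + element_energy \<epsilon> (right_triangle (x + h) s (- h) (- s)) U ?\<phi>)"
    by (rule sum_patch[OF hH])
  \<comment> \<open>The hat is 1 at the node and 0 at the other vertices, so each triple of its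
    values marks the position of the node.\<close>
  also have "\<dots> = (\<Sum>s\<in>{H, - H}.
      element_form \<epsilon> h s (U (x - h, 0), U (x, 0), U (x, s)) (0, 1, 0)
    + element_form \<epsilon> h s (U (x, 0), U (x + h, 0), U (x + h, s)) (1, 0, 0)
    + element_form \<epsilon> (- h) (- s) (U (x + h, s), U (x, s), U (x, 0)) (0, 0, 1))"
  proof (rule sum.cong[OF refl])
    fix s assume s: "s \<in> {H, - H}"
    then have K: "right_triangle (x - h) 0 h s \<in> patch x h H" "right_triangle x 0 h s \<in> patch x h H"
      "right_triangle (x + h) s (- h) (- s) \<in> patch x h H"
      unfolding patch_def by blast+
    have v: "?\<phi> (x, 0) = 1" "?\<phi> (x - h, 0) = 0" "?\<phi> (x + h, 0) = 0" "?\<phi> (x, s) = 0" "?\<phi> (x + h, s) = 0"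
      using s hH by (auto simp: hat_def field_simps)
    have s0: "s \<noteq> 0" "h \<noteq> 0" "- s \<noteq> 0" "- h \<noteq> 0" using s hH by auto
    have P: "element_energy \<epsilon> (right_triangle (x - h) 0 h s) U ?\<phi> =
        element_form \<epsilon> h s (U (x - h, 0), U (x, 0), U (x, s)) (0, 1, 0)"
      using element_energy_right_triangle[OF simp2 s0(2,1) aff[OF U K(1)] aff[OF hat K(1)]] K sub v
      by (simp add: subset_iff)
    have Q: "element_energy \<epsilon> (right_triangle x 0 h s) U ?\<phi> =
        element_form \<epsilon> h s (U (x, 0), U (x + h, 0), U (x + h, s)) (1, 0, 0)"
      using element_energy_right_triangle[OF simp2 s0(2,1) aff[OF U K(2)] aff[OF hat K(2)]] K sub v
      by (simp add: subset_iff)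
    have R: "element_energy \<epsilon> (right_triangle (x + h) s (- h) (- s)) U ?\<phi> =
        element_form \<epsilon> (- h) (- s) (U (x + h, s), U (x, s), U (x, 0)) (0, 0, 1)"
      using element_energy_right_triangle[OF simp2 s0(4,3) aff[OF U K(3)] aff[OF hat K(3)]] K sub v
      by (simp add: subset_iff)
    show "element_energy \<epsilon> (right_triangle (x - h) 0 h s) U ?\<phi>
        + element_energy \<epsilon> (right_triangle x 0 h s) U ?\<phi>
        + element_energy \<epsilon> (right_triangle (x + h) s (- h) (- s)) U ?\<phi>
      = element_form \<epsilon> h s (U (x - h, 0), U (x, 0), U (x, s)) (0, 1, 0)
        + element_form \<epsilon> h s (U (x, 0), U (x + h, 0), U (x + h, s)) (1, 0, 0)
        + element_form \<epsilon> (- h) (- s) (U (x + h, s), U (x, s), U (x, 0)) (0, 0, 1)"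
      unfolding P Q R ..
  qed
  also have "\<dots> = h * H * (\<alpha> * (2 * U (x, 0) - U (x - h, 0) - U (x + h, 0))
    + \<beta> * (2 * U (x, 0) - U (x, H) - U (x, - H))
    + U (x, 0) / 2 + (U (x - h, 0) + U (x + h, 0) + U (x, H) + U (x, - H) + U (x + h, H) + U (x + h, - H)) / 12)"
    using hH by (simp add: form field_simps)
  finally show ?thesis using hH by (simp add: \<alpha>_def \<beta>_def)
qed

section \<open>The lower bound\<close>

text \<open>The sums \<open>s k\<close> of values symmetric about the midpoint have second
  differences at most \<open>- 2 * \<gamma>\<close> and first increment at most
  \<open>- \<gamma>\<close>. Their increments are thus bounded by odd multiples of
  \<open>- \<gamma>\<close>, and the first k odd numbers add up to k^2.\<close>

lemma second_difference_midpoint: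
  fixes e :: "nat \<Rightarrow> real"
  assumes "\<And>i. 1 \<le> i \<Longrightarrow> i < 2 * N \<Longrightarrow> \<gamma> \<le> 2 * e i - e (i - 1) - e (i + 1)"
  shows "e 0 + e (2 * N) \<le> 2 * e N - \<gamma> * (real N)\<^sup>2"
proof -
  define s where "s k = e (N + k) + e (N - k)" for k
  have step: "s (Suc k) - s k \<le> - \<gamma> * (2 * real k + 1)" if "k < N" for k
    using that
  proof (induction k)
    case 0
    then show ?case using assms[of N] by (simp add: s_def)
  next
    case (Suc k)
    \<comment> \<open>Here \<open>Suc k < N\<close>, so the truncated subtractions are exact and the
      mirrored index is admissible.\<close>
    have "N - k - 1 - 1 = N - Suc (Suc k)" "N - k - 1 + 1 = N - k" "1 \<le> N - k - 1" "N - k - 1 < 2 * N" using Suc.prems by auto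
    then have "s (Suc (Suc k)) \<le> 2 * s (Suc k) - s k - 2 * \<gamma>"
      using assms[of "N + Suc k"] assms[of "N - k - 1"] Suc.prems by (simp add: s_def)
    then show ?case using Suc by (simp add: algebra_simps)
  qed
  have "s k \<le> 2 * e N - \<gamma> * (real k)\<^sup>2" if "k \<le> N" for k
    using that
  proof (induction k)
    case 0
    then show ?case by (simp add: s_def)
  next
    case (Suc k)
    then show ?case using step[of k] by (simp add: power2_eq_square algebra_simps)
  qed
  from this[of N] show ?thesis by (simp add: s_def flip: mult_2)
qed

text \<open>The product of the quadratic Taylor polynomials at \<open>x\<close> and
  \<open>- x\<close> is 1 + x^4/4, hence at least 1, and the one at \<open>x\<close> is a lower
  bound of \<open>exp x\<close>.\<close>

lemma exp_minus_upper_quadratic: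
  fixes x :: real
  assumes "0 \<le> x"
  shows "exp (- x) \<le> 1 - x + x\<^sup>2 / 2"
proof -
  have "(1 + x + x\<^sup>2 / 2) * (1 - x + x\<^sup>2 / 2) = 1 + (x\<^sup>2 / 2)\<^sup>2"
    by (simp add: power2_eq_square field_simps)
  moreover have "0 \<le> 1 - x + x\<^sup>2 / 2"
    using zero_le_power2[of "x - 1"] by (simp add: power2_eq_square algebra_simps)
  ultimately have "1 \<le> exp x * (1 - x + x\<^sup>2 / 2)"
    using mult_right_mono[OF exp_lower_Taylor_quadratic[OF assms], of "1 - x + x\<^sup>2 / 2"]
      zero_le_power2[of "x\<^sup>2 / 2"] by linarith
  then show ?thesis by (simp add: exp_minus field_simps)
qed

text \<open>The left side is the scheme applied to the exact solution, divided by its value at the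
  node. The 2/3 collects the node and its two vertical neighbours; of the other four neighbours one
  lies to the left and three to the right, and this asymmetry leaves a first-order term.\<close>

lemma exp_truncation_bound:
  fixes \<delta> :: real
  assumes "0 < \<delta>" "\<delta> \<le> 2 / 5"
  shows "(2 - exp \<delta> - exp (- \<delta>)) / \<delta>\<^sup>2 + 2 / 3 + (exp \<delta> + 3 * exp (- \<delta>)) / 12 \<le> - \<delta> / 12"
proof -
  have "\<delta> / 2 \<le> sinh (\<delta> / 2)" using exp_lower_Taylor_quadratic[of "\<delta> / 2"] exp_minus_upper_quadratic[of "\<delta> / 2"] assms
    by (simp add: sinh_def)
  moreover have "exp \<delta> + exp (- \<delta>) - 2 = (2 * sinh (\<delta> / 2))\<^sup>2"
    by (simp add: sinh_def power2_eq_square algebra_simps flip: exp_add)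
  ultimately have "\<delta>\<^sup>2 \<le> exp \<delta> + exp (- \<delta>) - 2"
    using assms power_mono[of \<delta> "2 * sinh (\<delta> / 2)" 2] by simp
  then have 1: "(2 - exp \<delta> - exp (- \<delta>)) / \<delta>\<^sup>2 \<le> - 1"
    using assms by (simp add: field_simps)
  have 2: "exp \<delta> \<le> 1 + \<delta> + \<delta>\<^sup>2" using assms by (intro exp_bound) auto
  have 3: "exp (- \<delta>) \<le> 1 - \<delta> + \<delta>\<^sup>2 / 2"
    using assms by (intro exp_minus_upper_quadratic) auto
  \<comment> \<open>The bounds 2 and 3 give at most 1 - \<delta>/6 + 5 \<delta>^2/24 for the mass
    part. The threshold 2/5 is exactly what keeps the quadratic term below half of the linear
    one.\<close>
  have "\<delta>\<^sup>2 \<le> 2 / 5 * \<delta>" using assms by (simp add: power2_eq_square mult_right_mono)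
  then have "2 / 3 + (exp \<delta> + 3 * exp (- \<delta>)) / 12 \<le> 1 - \<delta> / 12" using 2 3 by (simp add: field_simps)
  with 1 show ?thesis by argo
qed

section \<open>From the difference equation to the error bound\<close>

lemma type_B_elements:
  assumes "\<epsilon> > 0" "1 \<le> j" "j \<le> 2 * N" "s \<in> {H, - H}" and h: "h = \<epsilon> / real N"
  shows "right_triangle (h * real j - h) 0 h s \<in> type_B_triangulation \<epsilon> H N"
    and "right_triangle (h * real j) s (- h) (- s) \<in> type_B_triangulation \<epsilon> H N"
proof -
  have j: "h * real (j - 1) = h * real j - h"
    using assms(2) by (simp add: of_nat_diff algebra_simps)
  \<comment> \<open>The second element is listed from \<open>(h * real j, s)\<close> down to
    \<open>(h * real (j - 1), 0)\<close> along negative legs, so only the order of the vertices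
    changes.\<close>
  have "right_triangle (h * real j - h) 0 h s = convex hull {(h * real (j - 1), 0), (h * real j, 0), (h * real j, s)}"
    "right_triangle (h * real j) s (- h) (- s) = convex hull {(h * real (j - 1), 0), (h * real (j - 1), s), (h * real j, s)}"
    unfolding right_triangle_def j by (simp_all add: insert_commute)
  moreover have "j \<in> {1..2 * N}" using assms by auto
  ultimately show "right_triangle (h * real j - h) 0 h s \<in> type_B_triangulation \<epsilon> H N"
    "right_triangle (h * real j) s (- h) (- s) \<in> type_B_triangulation \<epsilon> H N"
    using assms(4) unfolding type_B_triangulation_def Let_def h[symmetric] by blast+
qed

lemma fe_error_lower_bound:
  fixes N :: nat
  assumes pos: "\<epsilon> > 0" "H > 0" and N: "1 \<le> N" "1 / real N \<le> 2 / 5" and poly: "polygonal_domain \<Omega>"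
    and sub: "{0<..<2 * \<epsilon>} \<times> {- H<..<H} \<subseteq> \<Omega>"
    and T: "triangulation_of \<T> \<Omega>" and TB: "type_B_triangulation \<epsilon> H N \<subseteq> \<T>"
    and sol: "is_fe_solution \<epsilon> \<Omega> \<T> (exact_solution \<epsilon>) U" and C: "\<epsilon> \<le> C * H"
  shows "exp (- 2) / (60 + 48 * C\<^sup>2) * (1 / real N) \<le> (SUP p\<in>closure \<Omega>. \<bar>U p - exact_solution \<epsilon> p\<bar>)"
proof -
  define E where "E = (SUP p\<in>closure \<Omega>. \<bar>U p - exact_solution \<epsilon> p\<bar>)"
  define h \<delta> where "h = \<epsilon> / real N" and "\<delta> = 1 / real N"
  have h0: "h > 0" and \<delta>: "0 < \<delta>" "\<delta> \<le> 2 / 5" using pos N by (auto simp: h_def \<delta>_def)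
  have h\<epsilon>: "h = \<epsilon> * \<delta>" by (simp add: h_def \<delta>_def)
  have opn: "open \<Omega>" and bnd: "bounded \<Omega>" using poly unfolding polygonal_domain_def by auto
  have un: "\<Union>\<T> = closure \<Omega>" using T unfolding triangulation_of_def by simp
  have contU: "continuous_on (closure \<Omega>) U" using sol unfolding is_fe_solution_def linear_fe_space_def by simp
  \<comment> \<open>A real supremum dominates the pointwise errors only if these are bounded above,
    which compactness provides.\<close>
  have "continuous_on (closure \<Omega>) (\<lambda>p. \<bar>U p - exact_solution \<epsilon> p\<bar>)"
    unfolding exact_solution_def by (intro continuous_intros contU) (use pos in auto)
  then have "compact ((\<lambda>p. \<bar>U p - exact_solution \<epsilon> p\<bar>) ` closure \<Omega>)"
    using bnd by (intro compact_continuous_image) auto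
  then have "bdd_above ((\<lambda>p. \<bar>U p - exact_solution \<epsilon> p\<bar>) ` closure \<Omega>)"
    by (intro bounded_imp_bdd_above compact_imp_bounded)
  then have E: "\<bar>U p - exact_solution \<epsilon> p\<bar> \<le> E" if "p \<in> closure \<Omega>" for p
    unfolding E_def using that by (rule cSUP_upper[rotated])
  have tri: "right_triangle (h * real j - h) 0 h s \<in> \<T>" "right_triangle (h * real j) s (- h) (- s) \<in> \<T>"
    if "1 \<le> j" "j \<le> 2 * N" "s \<in> {H, - H}" for j s
    using type_B_elements[OF pos(1) that h_def] TB by auto
  \<comment> \<open>Cells are indexed by their right end, so the nodes with \<open>j = 0\<close> are
    taken from cell 1.\<close>
  have node: "(h * real j, s) \<in> closure \<Omega>" if "j \<le> 2 * N" "s \<in> {H, - H} \<or> s = 0" for j s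
  proof (cases "j = 0")
    case True
    show ?thesis
    proof (cases "s = 0")
      case True
      then have "(h * real j, s) \<in> right_triangle (h * real 1 - h) 0 h H"
        using right_triangle_vertices(1)[where x = 0 and y = 0 and c = h and d = H] \<open>j = 0\<close> by simp
      then show ?thesis using tri(1)[of 1 H] N un by fastforce
    next
      case False
      then have s: "s \<in> {H, - H}" using that by auto
      have "(h * real j, s) \<in> right_triangle (h * real 1) s (- h) (- s)"
        using right_triangle_vertices(2)[where x = h and y = s and c = "- h" and d = "- s"] \<open>j = 0\<close> by simp
      then show ?thesis using tri(2)[of 1 s] s N un by fastforce
    qed
  next
    case False
    show ?thesis
    proof (cases "s = 0")
      case True
      then have "(h * real j, s) \<in> right_triangle (h * real j - h) 0 h H"
        using right_triangle_vertices(2)[where x = "h * real j - h" and y = 0 and c = h and d = H] by simp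
      then show ?thesis using tri(1)[of j H] \<open>j \<noteq> 0\<close> that un by fastforce
    next
      assume "s \<noteq> 0"
      then have s: "s \<in> {H, - H}" using that by auto
      have "(h * real j, s) \<in> right_triangle (h * real j) s (- h) (- s)"
        by (rule right_triangle_vertices(1))
      then show ?thesis using tri(2)[of j s] s \<open>j \<noteq> 0\<close> that un by fastforce
    qed
  qed
  define err where "err j s = U (h * real j, s) - exp (- \<delta> * real j)" for j s
  have ex: "exact_solution \<epsilon> (h * real j, s) = exp (- \<delta> * real j)" for j s
    using pos by (simp add: exact_solution_def h\<epsilon>)
  have errE: "\<bar>err j s\<bar> \<le> E" if "j \<le> 2 * N" "s \<in> {H, - H} \<or> s = 0" for j s
    using E[OF node[OF that]] unfolding ex err_def .
  \<comment> \<open>The truncation term minus the largest contribution of the lower-order error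
    terms; the sign of \<open>c\<close> is left open.\<close>
  define c where "c = exp (- 2) * \<delta> / 12 - (4 * C\<^sup>2 + 1) * E"
  have diff: "c * \<delta>\<^sup>2 \<le> 2 * err i 0 - err (i - 1) 0 - err (i + 1) 0" if i: "1 \<le> i" "i < 2 * N" for i
  proof -
    define x where "x = h * real i"
    have x: "x - h = h * real (i - 1)" "x + h = h * real (i + 1)"
      using i by (auto simp: x_def of_nat_diff algebra_simps)
    have "right_triangle (x - h) 0 h s \<in> \<T>" "right_triangle x 0 h s \<in> \<T>"
      "right_triangle (x + h) s (- h) (- s) \<in> \<T>" if "s \<in> {H, - H}" for s
      using tri(1)[of i s] tri[of "i + 1" s] i that unfolding x(2)[symmetric] x_def[symmetric] by simp_all
    then have "patch x h H \<subseteq> \<T>" unfolding patch_def by blast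
    moreover have "{x - h<..<x + h} \<times> {- H<..<H} \<subseteq> \<Omega>"
    proof -
      have "0 \<le> x - h" unfolding x using h0 by simp
      moreover have "x + h \<le> h * real (2 * N)" unfolding x using h0 i by (intro mult_left_mono) auto
      moreover have "h * real (2 * N) = 2 * \<epsilon>" using N by (simp add: h_def)
      ultimately have "{x - h<..<x + h} \<subseteq> {0<..<2 * \<epsilon>}" by auto
      then show ?thesis using sub by blast
    qed
    ultimately have "\<epsilon>\<^sup>2 / h\<^sup>2 * (2 * U (x, 0) - U (x - h, 0) - U (x + h, 0))
      + \<epsilon>\<^sup>2 / H\<^sup>2 * (2 * U (x, 0) - U (x, H) - U (x, - H))
      + U (x, 0) / 2 + (U (x - h, 0) + U (x + h, 0) + U (x, H) + U (x, - H) + U (x + h, H) + U (x + h, - H)) / 12 = 0"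
      by (intro fe_difference_equation[OF T opn sol h0 pos(2)])
    moreover have Ui: "U (x, s) = err i s + exp (- \<delta> * real i)" for s
      unfolding x_def err_def by simp
    moreover have Um: "U (x - h, s) = err (i - 1) s + exp (- \<delta> * real i) * exp \<delta>" for s
      unfolding x err_def using i by (simp add: of_nat_diff algebra_simps flip: exp_add)
    moreover have Up: "U (x + h, s) = err (i + 1) s + exp (- \<delta> * real i) * exp (- \<delta>)" for s
      unfolding x err_def by (simp add: algebra_simps flip: exp_add)
    moreover have "\<epsilon>\<^sup>2 / h\<^sup>2 = 1 / \<delta>\<^sup>2" using pos by (simp add: h\<epsilon> power_mult_distrib)
    moreover define \<rho> u where "\<rho> = \<epsilon>\<^sup>2 / H\<^sup>2" and "u = exp (- \<delta> * real i)"
    \<comment> \<open>Nodal values are split into error and exact value. The exact solution does not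
      depend on \<open>y\<close>, so it cancels in the difference weighted by
      \<open>\<rho>\<close>.\<close>
    ultimately have eq: "(2 * err i 0 - err (i - 1) 0 - err (i + 1) 0) / \<delta>\<^sup>2
      + \<rho> * (2 * err i 0 - err i H - err i (- H)) + err i 0 / 2
      + (err (i - 1) 0 + err (i + 1) 0 + err i H + err i (- H) + err (i + 1) H + err (i + 1) (- H)) / 12
      = u * - ((2 - exp \<delta> - exp (- \<delta>)) / \<delta>\<^sup>2 + 2 / 3 + (exp \<delta> + 3 * exp (- \<delta>)) / 12)"
      (is "?D / _ + \<rho> * ?R + _ + _ = _")
      by (simp add: algebra_simps add_divide_distrib diff_divide_distrib)
    \<comment> \<open>The patch has length \<open>2 * \<epsilon>\<close>, so the exact solution
      stays above \<open>exp (- 2)\<close>, the source of that constant.\<close>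
    have "real i * \<delta> \<le> 2" using i N by (simp add: \<delta>_def field_simps)
    then have u: "exp (- 2) \<le> u" unfolding u_def by (simp add: mult.commute)
    have "exp (- 2) * (\<delta> / 12) \<le> u * - ((2 - exp \<delta> - exp (- \<delta>)) / \<delta>\<^sup>2 + 2 / 3 + (exp \<delta> + 3 * exp (- \<delta>)) / 12)"
    proof (rule mult_mono[OF u])
      show "\<delta> / 12 \<le> - ((2 - exp \<delta> - exp (- \<delta>)) / \<delta>\<^sup>2 + 2 / 3 + (exp \<delta> + 3 * exp (- \<delta>)) / 12)"
        using exp_truncation_bound[OF \<delta>] by argo
    qed (use \<delta> in \<open>simp_all add: u_def\<close>)
    moreover have "\<rho> * ?R \<le> 4 * C\<^sup>2 * E"
    proof -
      have "\<epsilon>\<^sup>2 \<le> C\<^sup>2 * H\<^sup>2" using power_mono[OF C, of 2] pos by (simp add: power_mult_distrib)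
      then have \<rho>: "0 \<le> \<rho>" "\<rho> \<le> C\<^sup>2" using pos by (auto simp: \<rho>_def field_simps)
      have R: "?R \<le> 4 * E" using errE[of i 0] errE[of i H] errE[of i "- H"] i by simp
      have "0 \<le> E" using errE[of i 0] i by simp
      then have "\<rho> * ?R \<le> C\<^sup>2 * (4 * E)"
        using \<rho> R mult_left_mono[OF R \<rho>(1)] mult_right_mono[OF \<rho>(2), of "4 * E"] by linarith
      then show ?thesis by simp
    qed
    \<comment> \<open>The weights 1/2 and six times 1/12 add up to 1.\<close>
    moreover have "err i 0 / 2
      + (err (i - 1) 0 + err (i + 1) 0 + err i H + err i (- H) + err (i + 1) H + err (i + 1) (- H)) / 12 \<le> E"
    proof -
      have "err j s \<le> E" if "j \<in> {i - 1, i, i + 1}" "s \<in> {H, - H} \<or> s = 0" for j s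
        using errE[of j s] that i by (auto simp: le_diff_conv)
      then have "err i 0 \<le> E" "err (i - 1) 0 \<le> E" "err (i + 1) 0 \<le> E" "err i H \<le> E"
        "err i (- H) \<le> E" "err (i + 1) H \<le> E" "err (i + 1) (- H) \<le> E"
        by simp_all
      then show ?thesis by argo
    qed
    moreover have "a - b - e \<le> d" if "a \<le> r" "p \<le> b" "m + m' \<le> e" "d + p + m + m' = r" for a b d e r p m m' :: real
      using that by linarith
    ultimately have "exp (- 2) * (\<delta> / 12) - 4 * C\<^sup>2 * E - E \<le> ?D / \<delta>\<^sup>2"
      using eq by blast
    then have "c \<le> ?D / \<delta>\<^sup>2" unfolding c_def by (simp add: algebra_simps)
    then show ?thesis using \<delta> by (simp add: field_simps)
  qed
  have "err 0 0 + err (2 * N) 0 \<le> 2 * err N 0 - c * \<delta>\<^sup>2 * (real N)\<^sup>2"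
    by (rule second_difference_midpoint[where e = "\<lambda>i. err i 0"]) (rule diff)
  \<comment> \<open>The midpoint is \<open>N\<close> steps from either end, so the mesh size
    cancels.\<close>
  moreover have "\<delta>\<^sup>2 * (real N)\<^sup>2 = 1" using N by (simp add: \<delta>_def power_divide)
  ultimately have "c \<le> 2 * err N 0 - err 0 0 - err (2 * N) 0" by (simp add: mult.assoc)
  then have "c \<le> 4 * E" using errE[of N 0] errE[of 0 0] errE[of "2 * N" 0] by simp
  \<comment> \<open>Collecting \<open>4 * E\<close> and the \<open>(4 * C\<^sup>2 + 1) * E\<close>
    inside \<open>c\<close>, then multiplying by 12, gives 60 and 48.\<close>
  then have "exp (- 2) * \<delta> \<le> (60 + 48 * C\<^sup>2) * E" unfolding c_def by (simp add: algebra_simps)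
  moreover have "0 < 60 + 48 * C\<^sup>2" by (intro add_pos_nonneg) auto
  ultimately have "exp (- 2) / (60 + 48 * C\<^sup>2) * \<delta> \<le> E" by (simp add: field_simps)
  then show ?thesis unfolding E_def \<delta>_def .
qed

theorem lemma5p3:
  fixes C\<^sub>2 :: real
  assumes "C\<^sub>2 > 0"
  shows "\<exists>C\<^sub>0 C\<^sub>1 :: real. C\<^sub>0 > 0 \<and> C\<^sub>1 > 0 \<and>
    (\<forall>(\<epsilon> :: real) (H :: real) (N\<^sub>0 :: nat) (\<Omega> :: (real \<times> real) set)
      (\<T> :: (real \<times> real) set set) (U :: real \<times> real \<Rightarrow> real).
      \<epsilon> > 0 \<longrightarrow> H > 0 \<longrightarrow> N\<^sub>0 \<ge> 1 \<longrightarrow>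
      polygonal_domain \<Omega> \<longrightarrow>
      {0<..<2 * \<epsilon>} \<times> {- H<..<H} \<subseteq> \<Omega> \<longrightarrow>
      triangulation_of \<T> \<Omega> \<longrightarrow>
      type_B_triangulation \<epsilon> H N\<^sub>0 \<subseteq> \<T> \<longrightarrow>
      is_fe_solution \<epsilon> \<Omega> \<T> (exact_solution \<epsilon>) U \<longrightarrow>
      1 / real N\<^sub>0 \<le> C\<^sub>1 \<longrightarrow> \<epsilon> \<le> C\<^sub>2 * H \<longrightarrow>
      (SUP p\<in>closure \<Omega>. \<bar>U p - exact_solution \<epsilon> p\<bar>) \<ge> C\<^sub>0 * (1 / real N\<^sub>0))"
proof (rule exI[of _ "exp (- 2) / (60 + 48 * C\<^sub>2\<^sup>2)"], rule exI[of _ "2 / 5"], intro conjI allI impI)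
  \<comment> \<open>The first witness is the constant of \<open>fe_error_lower_bound\<close>, the
    second the threshold of \<open>exp_truncation_bound\<close>.\<close>
  show "0 < exp (- 2) / (60 + 48 * C\<^sub>2\<^sup>2)"
    by (intro divide_pos_pos add_pos_nonneg) auto
qed (simp, rule fe_error_lower_bound)

end
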